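(* Let $d\ge 1$, let $n_1,\dots,n_d>4$ be integers, let $\mathcal{C}=\prod_{k=1}^d\mathbb{Z}/n_k\mathbb{Z}$, let $Q\subseteq\mathbb{R}$ be a set with at least two elements and $0\in Q$, and let $f$ be a local rule for $d$-dimensional cellular automata with the von Neumann neighborhood (of range one) and state set $Q$. Fix any $\vec\eta\in V$ and any selection $\Lambda\subseteq\Omega$ containing exactly one pair from each two matching pairs. Then $f$ is number-conserving if and only if for every neighborhood configuration $N:V\to Q$ it holds that $$\begin{aligned} f(N)={}&N(\vec\eta)+\sum_{\{\vec u,\vec w\}\in\Lambda}\Big[f\big(D_{\vec u:N(\vec u),\,\vec w:N(\vec w)}\big)-f\big(D_{\vec u:N(-\vec w),\,\vec w:N(-\vec u)}\big)\Big]+\sum_{\vec v\in V\setminus\{\vec\eta\}}f^{E}\big(H_{N(\vec v)}\big)\\ &-\sum_{\{\vec u,\vec w\}\in\Lambda}\Big[f^{E}\big(D_{\vec u:N(\vec u),\,\vec w:N(\vec w)}\big)+f^{E}\big(D_{-\vec w:N(\vec u),\,-\vec u:N(\vec w)}\big)\Big]-\sum_{\vec v\in V_+}f\big(M_{\vec v:N(-\vec v)}\big). \end{aligned}$$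
   Context: Setting. The cell space is $\mathcal{C}=(\mathbb{Z}/n_1\mathbb{Z})\times\dots\times(\mathbb{Z}/n_d\mathbb{Z})$ with fixed $d\ge1$ and fixed integers $n_1,\dots,n_d>4$ (periodic boundary conditions). Let $\vec v_k$ be the $k$-th standard unit vector, $\vec 0$ the zero vector, $V_+=\{\vec v_1,-\vec v_1,\dots,\vec v_d,-\vec v_d\}$ and $V=V_+\cup\{\vec 0\}$; for $\mathbf{i}\in\mathcal{C}$ and $\vec v\in V$, the cell $\mathbf{i}+\vec v$ is computed componentwise modulo $n_1,\dots,n_d$. The state set $Q\subseteq\mathbb{R}$ (finite or infinite) has at least two elements and contains $0$. A neighborhood configuration is a function $N:V\to Q$; a local rule is a function $f$ from the set of all neighborhood configurations to $Q$. A configuration is a map $\mathbf{x}:\mathcal{C}\to Q$, and $\sigma(\mathbf{x})=\sum_{\mathbf{i}\in\mathcal{C}}\mathbf{x}(\mathbf{i})$. The global rule $F$ induced by $f$ is $F(\mathbf{x})(\mathbf{i})=f(N_{\mathbf{x},\mathbf{i}})$, where $N_{\mathbf{x},\mathbf{i}}(\vec v)=\mathbf{x}(\mathbf{i}+\vec v)$ for $\vec v\in V$. The local rule $f$ is number-conserving if $\sigma(F(\mathbf{x}))=\sigma(\mathbf{x})$ for every configuration $\mathbf{x}$. Pairs. $\Omega$ is the set of all unordered pairs $\{\vec 0,\vec v\}$ with $\vec v\in V_+$ together with all unordered pairs $\{\vec u,\vec v\}$ with $\vec u,\vec v\in V_+$, $\vec u\ne\vec v$, $\vec u\neq-\vec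 v$; it has $2d^2$ elements. The matching pair of $\{\vec u,\vec v\}\in\Omega$ is $\{-\vec u,-\vec v\}$ (with $-\vec 0=\vec 0$); it always differs from $\{\vec u,\vec v\}$. A set $\Lambda\subseteq\Omega$ is obtained by selecting exactly one pair out of each of the $d^2$ couples of matching pairs, so $|\Lambda|=d^2$. Special neighborhood configurations, for $p,q\in Q$: $H_q$ is constantly $q$ on $V$; the monomer $M_{\vec v:q}$ (for $\vec v\in V$) takes value $q$ at $\vec v$ and $0$ elsewhere; the dimer $D_{\vec u:p,\,\vec w:q}$ (for $\{\vec u,\vec w\}\in\Omega$) takes value $p$ at $\vec u$, $q$ at $\vec w$, and $0$ elsewhere (so $D_{\vec u:p,\,\vec w:q}=D_{\vec w:q,\,\vec u:p}$, and the summands in the claim do not depend on the order chosen for the pair). Monomer expansion of $f$: the real-valued function on neighborhood configurations $f^{E}(N)=\sum_{\vec v\in V}f\big(M_{\vec v:N(\vec v)}\big)$. *)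

theory Defs
  imports "HOL-Analysis.Finite_Cartesian_Product" "HOL-Library.FuncSet"
begin

text \<open>
  The dimension \<open>d\<close> is the cardinality of the index type \<open>'d\<close>, so \<open>d \<ge> 1\<close> holds automatically.
  Maps with a prescribed domain (configurations, neighborhood configurations) are extensional
  functions, i.e. elements of \<open>A \<rightarrow>\<^sub>E Q\<close>.
\<close>

subsection \<open>Cells, neighborhood, rules\<close>

definition cells :: "('d::finite \<Rightarrow> nat) \<Rightarrow> (int ^ 'd) set" where
  "cells n = {i. \<forall>k. 0 \<le> i $ k \<and> i $ k < int (n k)}"

definition shift :: "('d::finite \<Rightarrow> nat) \<Rightarrow> int ^ 'd \<Rightarrow> int ^ 'd \<Rightarrow> int ^ 'd" where
  "shift n i v = (\<chi> k. (i $ k + v $ k) mod int (n k))"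

definition Vplus :: "(int ^ 'd::finite) set" where
  "Vplus = (\<Union>k. {axis k 1, - axis k 1})"

definition V :: "(int ^ 'd::finite) set" where
  "V = insert 0 Vplus"

definition nbhd_configs :: "real set \<Rightarrow> (int ^ 'd::finite \<Rightarrow> real) set" where
  "nbhd_configs Q = V \<rightarrow>\<^sub>E Q"

definition local_rule :: "real set \<Rightarrow> ((int ^ 'd::finite \<Rightarrow> real) \<Rightarrow> real) \<Rightarrow> bool" where
  "local_rule Q f \<longleftrightarrow> f \<in> nbhd_configs Q \<rightarrow> Q"

definition configs :: "('d::finite \<Rightarrow> nat) \<Rightarrow> real set \<Rightarrow> (int ^ 'd \<Rightarrow> real) set" where
  "configs n Q = cells n \<rightarrow>\<^sub>E Q"

definition config_sum :: "('d::finite \<Rightarrow> nat) \<Rightarrow> (int ^ 'd \<Rightarrow> real) \<Rightarrow> real" where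
  "config_sum n x = (\<Sum>i\<in>cells n. x i)"

definition nbhd_at ::
    "('d::finite \<Rightarrow> nat) \<Rightarrow> (int ^ 'd \<Rightarrow> real) \<Rightarrow> int ^ 'd \<Rightarrow> (int ^ 'd \<Rightarrow> real)" where
  "nbhd_at n x i = (\<lambda>v\<in>V. x (shift n i v))"

definition global_rule ::
    "('d::finite \<Rightarrow> nat) \<Rightarrow> ((int ^ 'd \<Rightarrow> real) \<Rightarrow> real) \<Rightarrow> (int ^ 'd \<Rightarrow> real) \<Rightarrow> (int ^ 'd \<Rightarrow> real)" where
  "global_rule n f x = (\<lambda>i\<in>cells n. f (nbhd_at n x i))"

definition number_conserving ::
    "('d::finite \<Rightarrow> nat) \<Rightarrow> real set \<Rightarrow> ((int ^ 'd \<Rightarrow> real) \<Rightarrow> real) \<Rightarrow> bool" where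
  "number_conserving n Q f \<longleftrightarrow>
     (\<forall>x\<in>configs n Q. config_sum n (global_rule n f x) = config_sum n x)"

subsection \<open>Pairs\<close>

text \<open>Unordered pairs are represented as two-element sets.\<close>

definition Omega :: "(int ^ 'd::finite) set set" where
  "Omega = {{0, v} | v. v \<in> Vplus} \<union>
           {{u, v} | u v. u \<in> Vplus \<and> v \<in> Vplus \<and> u \<noteq> v \<and> u \<noteq> - v}"

definition matching_pair :: "(int ^ 'd::finite) set \<Rightarrow> (int ^ 'd) set" where
  "matching_pair P = uminus ` P"

definition selection :: "(int ^ 'd::finite) set set \<Rightarrow> bool" where
  "selection \<Lambda> \<longleftrightarrow> \<Lambda> \<subseteq> Omega \<and> (\<forall>P\<in>Omega. \<exists>!R. R \<in> {P, matching_pair P} \<and> R \<in> \<Lambda>)"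

text \<open>
  \<open>pair_sum g \<Lambda>\<close> is the sum of \<open>g u w\<close> over the unordered pairs \<open>{u, w} \<in> \<Lambda>\<close>. It is meaningful when
  the summand does not depend on the order chosen for the pair; see \<open>on_pair_eq\<close>, and
  \<open>dimer_commute\<close> for the summands of interest.
\<close>

definition on_pair :: "('a \<Rightarrow> 'a \<Rightarrow> real) \<Rightarrow> 'a set \<Rightarrow> real" where
  "on_pair g P = (THE s. \<exists>u w. P = {u, w} \<and> s = g u w)"

lemma on_pair_eq:
  assumes "g u w = g w u"
  shows "on_pair g {u, w} = g u w"
  unfolding on_pair_def by (rule the_equality) (use assms in \<open>auto simp: doubleton_eq_iff\<close>)

definition pair_sum :: "('a \<Rightarrow> 'a \<Rightarrow> real) \<Rightarrow> 'a set set \<Rightarrow> real" where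
  "pair_sum g \<Lambda> = (\<Sum>P\<in>\<Lambda>. on_pair g P)"

subsection \<open>Special neighborhood configurations\<close>

definition homog :: "real \<Rightarrow> (int ^ 'd::finite \<Rightarrow> real)" where
  "homog q = (\<lambda>v\<in>V. q)"

definition monomer :: "int ^ 'd::finite \<Rightarrow> real \<Rightarrow> (int ^ 'd \<Rightarrow> real)" where
  "monomer v q = (\<lambda>z\<in>V. if z = v then q else 0)"

definition dimer :: "int ^ 'd::finite \<Rightarrow> real \<Rightarrow> int ^ 'd \<Rightarrow> real \<Rightarrow> (int ^ 'd \<Rightarrow> real)" where
  "dimer u p w q = (\<lambda>z\<in>V. if z = u then p else if z = w then q else 0)"

lemma dimer_commute: "u \<noteq> w \<Longrightarrow> dimer u p w q = dimer w q u p"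
  by (auto simp: dimer_def fun_eq_iff restrict_def)

definition monomer_expansion ::
    "((int ^ 'd::finite \<Rightarrow> real) \<Rightarrow> real) \<Rightarrow> (int ^ 'd \<Rightarrow> real) \<Rightarrow> real" where
  "monomer_expansion f N = (\<Sum>v\<in>V. f (monomer v (N v)))"

end

theory Submission
  imports Defs
begin

text \<open>
  For the direct implication, apply conservation to a configuration equal to \<open>N\<close> on one cross and
  to 0 elsewhere. Away from the centre, every cell sees at most two states of the cross, so this
  expresses \<open>f N\<close> by values of \<open>f\<close> at dimers (one per pair in \<open>Omega\<close>) and monomers. Taking \<open>N\<close> to be
  a monomer or a dimer gives \<open>f\<^sup>E(H\<^sub>q) = q\<close> and a relation between the values at the two dimers of a
  matching couple, which eliminates half of the dimers.

  Conversely, sum the formula over all cells. The bracketed dimer differences cancel by translation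
  invariance, and all the monomer terms cancel by counting how many pairs contain a given vector.
\<close>

subsection \<open>The neighborhood\<close>

lemma finite_Vplus: "finite Vplus" and finite_V: "finite V"
  by (simp_all add: V_def Vplus_def)

lemma zero_notin_Vplus: "0 \<notin> Vplus"
  by (auto simp: Vplus_def vec_eq_iff axis_def)

lemma zero_in_V: "0 \<in> V"
  by (simp add: V_def)

lemma Vplus_iff: "v \<in> Vplus \<longleftrightarrow> v \<in> V \<and> v \<noteq> 0"
  using zero_notin_Vplus by (auto simp: V_def)

lemma uminus_in_Vplus: "- v \<in> Vplus \<longleftrightarrow> v \<in> Vplus" for v :: "int ^ 'd::finite"
proof -
  have "- v \<in> Vplus" if "v \<in> Vplus" for v :: "int ^ 'd"
    using that by (auto simp: Vplus_def)
  from this[of v] this[of "- v"] show ?thesis by auto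
qed

lemma uminus_in_V: "- v \<in> V \<longleftrightarrow> v \<in> V"
  using uminus_in_Vplus[of v] by (auto simp: V_def)

lemma neq_uminus: "v \<noteq> 0 \<Longrightarrow> v \<noteq> - v" for v :: "int ^ 'd::finite"
  by (auto simp: vec_eq_iff)

lemma V_coord_other: "v \<in> V \<Longrightarrow> v $ k \<noteq> 0 \<Longrightarrow> j \<noteq> k \<Longrightarrow> v $ j = 0"
  by (auto simp: V_def Vplus_def axis_def split: if_splits)

lemma V_eqI: "v \<in> V \<Longrightarrow> w \<in> V \<Longrightarrow> v $ k = w $ k \<Longrightarrow> v $ k \<noteq> 0 \<Longrightarrow> v = w"
  unfolding vec_eq_iff by (metis V_coord_other)

lemma V_coord_bound: "v \<in> V \<Longrightarrow> \<bar>v $ k\<bar> \<le> 1"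
  by (auto simp: V_def Vplus_def axis_def)

text \<open>Entries of vectors in \<open>V\<close> lie between -1 and 1. In a coordinate where
  \<open>a\<close> is non-zero, equality of the two sums therefore makes \<open>c\<close> or
  \<open>e\<close> agree with \<open>a\<close>, unless \<open>b\<close> cancels \<open>a\<close>
  there; a non-zero coordinate determines an element of \<open>V\<close>. This is what lets a cell
  near a cross identify the positions that it sees.\<close>

lemma V_sum_eq_cases:
  assumes "a \<in> V" "b \<in> V" "c \<in> V" "e \<in> V"
    and sum: "a + b = c + e" and nz: "a + b \<noteq> 0"
  shows "a = c \<and> b = e \<or> a = e \<and> b = c"
proof -
  have *: "a = c \<or> a = e"
    if V: "a \<in> V" "b \<in> V" "c \<in> V" "e \<in> V" and sum: "a + b = c + e" and "a + b \<noteq> 0" "a \<noteq> 0"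
    for a b c e :: "int ^ 'd"
  proof -
    obtain k where k: "a $ k \<noteq> 0"
      using \<open>a \<noteq> 0\<close> by (auto simp: vec_eq_iff)
    have "a $ k + b $ k = c $ k + e $ k"
      using sum by (metis vector_add_component)
    moreover have "\<bar>a $ k\<bar> \<le> 1" "\<bar>b $ k\<bar> \<le> 1" "\<bar>c $ k\<bar> \<le> 1" "\<bar>e $ k\<bar> \<le> 1"
      using V by (auto intro: V_coord_bound)
    ultimately consider "c $ k = a $ k" | "e $ k = a $ k" | "b $ k = - (a $ k)"
      using k by linarith
    then show ?thesis
    proof cases
      case 3
      \<comment> \<open>Cancellation in coordinate \<open>k\<close> makes both entries non-zero, so
        \<open>a\<close> and \<open>b\<close> vanish in every other coordinate.\<close>
      have "a $ j + b $ j = 0" for j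
        by (cases "j = k") (use 3 k V V_coord_other[of a k j] V_coord_other[of b k j] in auto)
      then have "a + b = 0" by (simp add: vec_eq_iff)
      then show ?thesis using \<open>a + b \<noteq> 0\<close> by simp
    qed (use V k V_eqI[of c a k] V_eqI[of e a k] in auto)
  qed
  show ?thesis
  proof (cases "a = 0")
    case True
    then have "b = c \<or> b = e"
      using *[of b a c e] assms by (auto simp: add.commute)
    then show ?thesis using sum True by auto
  next
    case False
    then have "a = c \<or> a = e" using *[of a b c e] assms by auto
    then show ?thesis using sum by auto
  qed
qed

lemma sum_V: "sum g V = g 0 + sum g Vplus"
  by (simp add: V_def finite_Vplus zero_notin_Vplus)

lemma card_V: "card (V :: (int ^ 'd::finite) set) = Suc (card (Vplus :: (int ^ 'd) set))"
  by (simp add: V_def finite_Vplus zero_notin_Vplus)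

lemma sum_uminus_V: "(\<Sum>v\<in>V. g (- v)) = sum g V"
  and sum_uminus_Vplus: "(\<Sum>v\<in>Vplus. g (- v)) = sum g Vplus"
  by (rule sum.reindex_bij_witness[of _ uminus uminus]; simp add: uminus_in_V uminus_in_Vplus)+

subsection \<open>Sums over pairs\<close>

text \<open>One description covers both kinds of pairs: when one vector is 0, the conditions
  \<open>u \<noteq> w\<close> and \<open>u \<noteq> - w\<close> both say that the other is
  non-zero.\<close>

lemma Omega_eq:
  "(Omega :: (int ^ 'd::finite) set set) = {{u, w} | u w. u \<in> V \<and> w \<in> V \<and> u \<noteq> w \<and> u \<noteq> - w}"
  (is "_ = ?R")
proof
  show "Omega \<subseteq> ?R"
  proof
    fix P :: "(int ^ 'd) set" assume "P \<in> Omega"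
    then consider v where "P = {0, v}" "v \<in> Vplus"
      | u v where "P = {u, v}" "u \<in> Vplus" "v \<in> Vplus" "u \<noteq> v" "u \<noteq> - v"
      unfolding Omega_def by auto
    then show "P \<in> ?R"
    proof cases
      case 1
      then show ?thesis
        by (intro CollectI exI[of _ 0] exI[of _ v]) (auto simp: Vplus_iff zero_in_V)
    next
      case 2
      then show ?thesis
        by (intro CollectI exI[of _ u] exI[of _ v]) (auto simp: Vplus_iff)
    qed
  qed
  have "{u, w} \<in> Omega" if "u \<in> V" "w \<in> V" "u \<noteq> w" "u \<noteq> - w" for u w :: "int ^ 'd"
  proof (cases "u = 0 \<or> w = 0")
    case True
    then have "{u, w} = {0, w} \<and> w \<in> Vplus \<or> {u, w} = {0, u} \<and> u \<in> Vplus"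
      using that by (auto simp: Vplus_iff)
    then show ?thesis unfolding Omega_def by blast
  next
    case False
    then show ?thesis using that unfolding Omega_def Vplus_iff by blast
  qed
  then show "?R \<subseteq> Omega" by (auto simp only:)
qed

lemma doubleton_in_Omega:
  "{u, w} \<in> Omega \<longleftrightarrow> u \<in> V \<and> w \<in> V \<and> u \<noteq> w \<and> u \<noteq> - w"
  using equation_minus_iff[of u w] unfolding Omega_eq by (auto simp: doubleton_eq_iff)

lemma finite_Omega: "finite Omega"
proof (rule finite_subset)
  show "Omega \<subseteq> Pow V" by (auto simp: Omega_eq)
qed (simp add: finite_V)

text \<open>Ordered versions of the pairs turn a pair sum into an ordinary double sum, to which
  reindexing by swaps and negation applies.\<close>

definition opairs :: "'a set set \<Rightarrow> ('a \<times> 'a) set" where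
  "opairs \<Lambda> = {(u, w). {u, w} \<in> \<Lambda>}"

lemma opairs_Omega: "opairs Omega = {(u, w) \<in> V \<times> V. u \<noteq> w \<and> u \<noteq> - w}"
  by (auto simp: opairs_def doubleton_in_Omega)

lemma finite_opairs: "\<Lambda> \<subseteq> Omega \<Longrightarrow> finite (opairs \<Lambda>)"
  by (rule finite_subset[of _ "V \<times> V"]) (auto simp: opairs_def doubleton_in_Omega finite_V)

text \<open>The factor 2 arises because a pair in \<open>Omega\<close> has two distinct elements,
  hence exactly two orderings.\<close>

lemma pair_sum_opairs:
  assumes \<Lambda>: "\<Lambda> \<subseteq> Omega" and sym: "\<And>u w. {u, w} \<in> \<Lambda> \<Longrightarrow> g u w = g w u"
  shows "2 * pair_sum g \<Lambda> = (\<Sum>(u, w)\<in>opairs \<Lambda>. g u w)"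
proof -
  have "(\<Sum>(u, w)\<in>opairs \<Lambda>. g u w)
      = (\<Sum>P\<in>\<Lambda>. \<Sum>(u, w) | (u, w) \<in> opairs \<Lambda> \<and> {u, w} = P. g u w)"
    using sum.group[OF finite_opairs[OF \<Lambda>] finite_subset[OF \<Lambda> finite_Omega],
        of "\<lambda>(u, w). {u, w}" "\<lambda>(u, w). g u w"]
    by (simp add: opairs_def case_prod_unfold image_subset_iff)
  also have "\<dots> = (\<Sum>P\<in>\<Lambda>. 2 * on_pair g P)"
  proof (rule sum.cong[OF refl])
    fix P assume P: "P \<in> \<Lambda>"
    then obtain u w where uw: "P = {u, w}" "u \<noteq> w"
      using \<Lambda> by (auto simp: Omega_eq)
    then have "{w, u} \<in> \<Lambda>" using P by (simp add: insert_commute)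
    with uw have "{(a, b). (a, b) \<in> opairs \<Lambda> \<and> {a, b} = P} = {(u, w), (w, u)}"
      using P by (auto simp: opairs_def doubleton_eq_iff)
    then show "(\<Sum>(u, w) | (u, w) \<in> opairs \<Lambda> \<and> {u, w} = P. g u w) = 2 * on_pair g P"
      using uw sym[of u w] P by (simp add: on_pair_eq)
  qed
  finally show ?thesis by (simp add: pair_sum_def sum_distrib_left)
qed

text \<open>The assumption reaches both orders of every pair, so the predicates under
  \<open>THE\<close> coincide, even for asymmetric summands.\<close>

lemma pair_sum_cong:
  assumes "\<And>u w. {u, w} \<in> \<Lambda> \<Longrightarrow> g u w = h u w"
  shows "pair_sum g \<Lambda> = pair_sum h \<Lambda>"
  unfolding pair_sum_def on_pair_def
  by (rule sum.cong[OF refl], rule arg_cong[of _ _ The], rule ext) (metis assms)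

lemma pair_sum_add:
  assumes \<Lambda>: "\<Lambda> \<subseteq> Omega"
    and "\<And>u w. {u, w} \<in> \<Lambda> \<Longrightarrow> g u w = g w u" "\<And>u w. {u, w} \<in> \<Lambda> \<Longrightarrow> h u w = h w u"
  shows "pair_sum (\<lambda>u w. g u w + h u w) \<Lambda> = pair_sum g \<Lambda> + pair_sum h \<Lambda>"
proof -
  have "on_pair (\<lambda>u w. g u w + h u w) P = on_pair g P + on_pair h P" if P: "P \<in> \<Lambda>" for P
  proof -
    obtain u w where "P = {u, w}" using P \<Lambda> by (auto simp: Omega_eq)
    then show ?thesis using P assms(2,3)[of u w] by (simp add: on_pair_eq)
  qed
  then show ?thesis by (simp add: pair_sum_def sum.distrib)
qed

text \<open>The ordered pairs of \<open>Omega\<close> fill the square \<open>V \<times> V\<close>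
  except for its diagonal and antidiagonal. The symmetrized summand absorbs the factor 2.\<close>

lemma pair_sum_Omega:
  "pair_sum (\<lambda>u w. g u w + g w u) Omega
   = (\<Sum>u\<in>V. (\<Sum>w\<in>V. g u w) - g u u) - (\<Sum>u\<in>Vplus. g u (- u))"
proof -
  have "(\<Sum>(u, w)\<in>opairs Omega. g w u) = (\<Sum>(u, w)\<in>opairs Omega. g u w)"
    by (rule sum.reindex_bij_witness[of _ prod.swap prod.swap])
      (auto simp: opairs_def insert_commute)
  then have "2 * pair_sum (\<lambda>u w. g u w + g w u) Omega = 2 * (\<Sum>(u, w)\<in>opairs Omega. g u w)"
    by (subst pair_sum_opairs) (auto simp: sum.distrib case_prod_unfold)
  moreover have "(\<Sum>(u, w)\<in>opairs Omega. g u w) = (\<Sum>u\<in>V. \<Sum>w | w \<in> V \<and> u \<noteq> w \<and> u \<noteq> - w. g u w)"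
    by (subst sum.Sigma) (auto simp: finite_V opairs_Omega intro!: sum.cong)
  moreover have "(\<Sum>w | w \<in> V \<and> u \<noteq> w \<and> u \<noteq> - w. g u w)
      = (\<Sum>w\<in>V. g u w) - g u u - (if u \<in> Vplus then g u (- u) else 0)" if "u \<in> V" for u
  proof (cases "u = 0")
    case True
    \<comment> \<open>At \<open>u = 0\<close> diagonal and antidiagonal meet, so a single term is
      removed; hence the antidiagonal correction runs over \<open>Vplus\<close> only.\<close>
    have "{w. w \<in> V \<and> u \<noteq> w \<and> u \<noteq> - w} = V - {u}" using True by auto
    then show ?thesis using True that
      by (simp add: sum_diff finite_V zero_notin_Vplus)
  next
    case False
    have "{w. w \<in> V \<and> u \<noteq> w \<and> u \<noteq> - w} = V - {u, - u}" by auto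
    then show ?thesis using that False neq_uminus[OF False]
      by (simp add: sum_diff finite_V uminus_in_V Vplus_iff)
  qed
  moreover have "(\<Sum>u\<in>V. (if u \<in> Vplus then g u (- u) else 0)) = (\<Sum>u\<in>Vplus. g u (- u))"
    by (simp add: V_def finite_Vplus zero_notin_Vplus)
  ultimately show ?thesis by (simp add: sum_subtractf)
qed

lemma opairs_uminus_Omega: "(- u, - w) \<in> opairs Omega \<longleftrightarrow> (u, w) \<in> opairs Omega"
  by (auto simp: opairs_Omega uminus_in_V)

text \<open>Negating both vectors maps the ordered pairs of \<open>\<Lambda>\<close> bijectively
  onto those of its complement in \<open>Omega\<close>, so adding the negated summand restores the
  sum over all pairs.\<close>

lemma pair_sum_selection:
  assumes sel: "selection \<Lambda>" and sym: "\<And>u w. {u, w} \<in> Omega \<Longrightarrow> g u w = g w u"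
  shows "pair_sum (\<lambda>u w. g u w + g (- u) (- w)) \<Lambda> = pair_sum g Omega"
proof -
  have \<Lambda>: "\<Lambda> \<subseteq> Omega" using sel by (simp add: selection_def)
  \<comment> \<open>Since a pair differs from its matching pair, choosing exactly one of the two
    becomes an exclusive alternative.\<close>
  have xor: "(u, w) \<in> opairs \<Lambda> \<longleftrightarrow> (- u, - w) \<notin> opairs \<Lambda>" if "(u, w) \<in> opairs Omega" for u w
  proof -
    have "{- u, - w} \<noteq> {u, w}"
      using that neq_uminus[of u] neq_uminus[of w]
      by (auto simp: opairs_Omega doubleton_eq_iff)
    moreover have "\<exists>!R. R \<in> {{u, w}, matching_pair {u, w}} \<and> R \<in> \<Lambda>"
      using sel that by (simp only: selection_def opairs_def) blast
    ultimately show ?thesis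
      unfolding opairs_def matching_pair_def by simp metis
  qed
  have "2 * pair_sum g Omega = (\<Sum>(u, w)\<in>opairs Omega. g u w)"
    by (rule pair_sum_opairs) (use sym in auto)
  also have "\<dots> = (\<Sum>(u, w)\<in>opairs \<Lambda>. g u w) + (\<Sum>(u, w)\<in>opairs Omega - opairs \<Lambda>. g u w)"
    using \<Lambda> by (subst sum.subset_diff[of "opairs \<Lambda>"]) (auto simp: opairs_def intro: finite_opairs[unfolded opairs_def])
  also have "(\<Sum>(u, w)\<in>opairs Omega - opairs \<Lambda>. g u w) = (\<Sum>(u, w)\<in>opairs \<Lambda>. g (- u) (- w))"
    by (rule sum.reindex_bij_witness[of _ "\<lambda>(u, w). (- u, - w)" "\<lambda>(u, w). (- u, - w)"])
      (use xor \<Lambda> opairs_uminus_Omega in \<open>fastforce simp: opairs_def\<close>)+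
  also have "(\<Sum>(u, w)\<in>opairs \<Lambda>. g u w) + \<dots> = 2 * pair_sum (\<lambda>u w. g u w + g (- u) (- w)) \<Lambda>"
  proof (subst pair_sum_opairs[OF \<Lambda>])
    fix u w assume "{u, w} \<in> \<Lambda>"
    then have "{u, w} \<in> Omega" using \<Lambda> by auto
    then show "g u w + g (- u) (- w) = g w u + g (- w) (- u)"
      using sym[of u w] sym[of "- u" "- w"] opairs_uminus_Omega[of u w] by (simp add: opairs_def)
  qed (simp add: sum.distrib case_prod_unfold)
  finally show ?thesis by simp
qed

lemma pair_sum_sum:
  assumes \<Lambda>: "\<Lambda> \<subseteq> Omega" and "\<And>i u w. {u, w} \<in> \<Lambda> \<Longrightarrow> g i u w = g i w u"
  shows "(\<Sum>i\<in>I. pair_sum (g i) \<Lambda>) = pair_sum (\<lambda>u w. \<Sum>i\<in>I. g i u w) \<Lambda>"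
proof -
  have "(\<Sum>i\<in>I. on_pair (g i) P) = on_pair (\<lambda>u w. \<Sum>i\<in>I. g i u w) P" if P: "P \<in> \<Lambda>" for P
  proof -
    obtain u w where "P = {u, w}" using P \<Lambda> by (auto simp: Omega_eq)
    then show ?thesis using P assms(2)[of u w] by (simp add: on_pair_eq)
  qed
  then show ?thesis
    unfolding pair_sum_def by (subst sum.swap) simp
qed

lemma pair_sum_single:
  assumes \<Lambda>: "\<Lambda> \<subseteq> Omega" and uw: "{u, w} \<in> \<Lambda>" and sym: "g u w = g w u"
    and zero: "\<And>a b. {a, b} \<in> \<Lambda> \<Longrightarrow> {a, b} \<noteq> {u, w} \<Longrightarrow> g a b = 0"
  shows "pair_sum g \<Lambda> = g u w"
proof -
  have "on_pair g P = (if P = {u, w} then g u w else 0)" if P: "P \<in> \<Lambda>" for P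
  proof -
    obtain a b where ab: "P = {a, b}" using P \<Lambda> by (auto simp: Omega_eq)
    then show ?thesis
      using on_pair_eq[of g u w, OF sym] on_pair_eq[of g a b] zero[of a b] zero[of b a] P
      by (auto simp: insert_commute)
  qed
  then have "pair_sum g \<Lambda> = (\<Sum>P\<in>\<Lambda>. if P = {u, w} then g u w else 0)"
    unfolding pair_sum_def by (rule sum.cong[OF refl])
  then show ?thesis
    using uw finite_subset[OF \<Lambda> finite_Omega] by simp
qed

lemma pair_sum_0: "\<Lambda> \<subseteq> Omega \<Longrightarrow> pair_sum (\<lambda>u w. 0) \<Lambda> = 0"
  unfolding pair_sum_def by (rule sum.neutral) (auto simp: Omega_eq on_pair_eq)

subsection \<open>Monomers and dimers\<close>

lemma monomer_0: "monomer v 0 = homog 0"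
  by (auto simp: monomer_def homog_def restrict_def)

lemma dimer_0: "dimer u p w 0 = monomer u p"
  by (auto simp: monomer_def dimer_def restrict_def)

lemma dimer_0': "u \<noteq> w \<Longrightarrow> dimer u 0 w q = monomer w q"
  by (auto simp: monomer_def dimer_def restrict_def)

lemma homog_in: "q \<in> Q \<Longrightarrow> homog q \<in> nbhd_configs Q"
  and monomer_in: "q \<in> Q \<Longrightarrow> 0 \<in> Q \<Longrightarrow> monomer v q \<in> nbhd_configs Q"
  and dimer_in: "p \<in> Q \<Longrightarrow> q \<in> Q \<Longrightarrow> 0 \<in> Q \<Longrightarrow> dimer v p w q \<in> nbhd_configs Q"
  by (auto simp: nbhd_configs_def homog_def monomer_def dimer_def)

lemma monomer_apply: "z \<in> V \<Longrightarrow> monomer v q z = (if z = v then q else 0)"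
  by (simp add: monomer_def)

lemma dimer_apply: "z \<in> V \<Longrightarrow> dimer v p w q z = (if z = v then p else if z = w then q else 0)"
  by (simp add: dimer_def)

text \<open>At every vector other than \<open>u\<close> and \<open>w\<close> the monomer is
  \<open>homog 0\<close>, where \<open>f\<close> vanishes.\<close>

lemma monomer_expansion_dimer:
  assumes "f (homog 0) = 0" "u \<in> V" "w \<in> V" "u \<noteq> w"
  shows "monomer_expansion f (dimer u p w q) = f (monomer u p) + f (monomer w q)"
proof -
  have "monomer_expansion f (dimer u p w q)
      = (\<Sum>v\<in>V. (if v = u then f (monomer u p) else 0) + (if v = w then f (monomer w q) else 0))"
    unfolding monomer_expansion_def
    by (rule sum.cong) (use assms in \<open>auto simp: dimer_apply monomer_0\<close>)
  then show ?thesis using assms by (simp add: sum.distrib finite_V)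
qed

lemma monomer_expansion_homog: "monomer_expansion f (homog q) = (\<Sum>v\<in>V. f (monomer v q))"
  by (simp add: monomer_expansion_def homog_def)

lemma monomer_expansion_monomer:
  assumes "f (homog 0) = 0" "v \<in> V"
  shows "monomer_expansion f (monomer v q) = f (monomer v q)"
proof -
  have "monomer_expansion f (monomer v q) = (\<Sum>z\<in>V. if z = v then f (monomer v q) else 0)"
    unfolding monomer_expansion_def
    by (rule sum.cong) (use assms in \<open>auto simp: monomer_apply monomer_0\<close>)
  then show ?thesis using assms by (simp add: finite_V)
qed

subsection \<open>Configurations on the torus\<close>

lemma finite_cells: "finite (cells n)" for n :: "'d::finite \<Rightarrow> nat"
proof -
  have "cells n \<subseteq> vec_lambda ` (\<Pi>\<^sub>E k\<in>UNIV. {0..<int (n k)})"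
  proof
    fix i assume "i \<in> cells n"
    then have "vec_nth i \<in> (\<Pi>\<^sub>E k\<in>UNIV. {0..<int (n k)})" by (auto simp: cells_def)
    then show "i \<in> vec_lambda ` (\<Pi>\<^sub>E k\<in>UNIV. {0..<int (n k)})"
      by (intro image_eqI[of _ _ "vec_nth i"]) auto
  qed
  then show ?thesis by (rule finite_subset) (simp add: finite_PiE)
qed

lemma shift_shift: "shift n (shift n i u) w = shift n i (u + w)"
  by (simp add: shift_def vec_eq_iff mod_add_left_eq add.assoc)

lemma shift_0: "i \<in> cells n \<Longrightarrow> shift n i 0 = i"
  by (simp add: shift_def cells_def vec_eq_iff)

lemma config_value: "x \<in> configs n Q \<Longrightarrow> i \<in> cells n \<Longrightarrow> x i \<in> Q"
  by (auto simp: configs_def)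

locale torus =
  fixes n :: "'d::finite \<Rightarrow> nat"
  assumes n_gt_4: "n k > 4"
begin

lemma shift_in_cells: "shift n i v \<in> cells n"
proof -
  have "int (n k) > 0" for k using n_gt_4[of k] by simp
  then show ?thesis by (simp add: cells_def shift_def)
qed

lemma card_cells_pos: "card (cells n) > 0"
  using shift_in_cells finite_cells by (auto simp: card_gt_0_iff)

lemma sum_shift: "(\<Sum>i\<in>cells n. g (shift n i v)) = sum g (cells n)"
  by (rule sum.reindex_bij_witness[of _ "\<lambda>i. shift n i (- v)" "\<lambda>i. shift n i v"])
    (auto simp: shift_in_cells shift_shift shift_0)

lemma nbhd_at_in: "x \<in> configs n Q \<Longrightarrow> nbhd_at n x i \<in> nbhd_configs Q"
  by (auto simp: nbhd_configs_def nbhd_at_def intro: config_value shift_in_cells)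

text \<open>In each coordinate the difference is a multiple of \<open>n k\<close> of absolute value
  below \<open>n k\<close>, hence 0.\<close>

lemma shift_inj:
  assumes "\<And>k. \<bar>y $ k - c $ k\<bar> < int (n k)" "shift n i y = shift n i c"
  shows "y = c"
proof -
  have "y $ k = c $ k" for k
  proof -
    have "(i $ k + y $ k) mod int (n k) = (i $ k + c $ k) mod int (n k)"
      using assms(2) by (simp add: shift_def vec_eq_iff)
    then have "int (n k) dvd y $ k - c $ k"
      by (simp add: mod_eq_dvd_iff)
    then show ?thesis
      using assms(1)[of k] dvd_imp_le_int[of "y $ k - c $ k" "int (n k)"] by fastforce
  qed
  then show ?thesis by (simp add: vec_eq_iff)
qed

text \<open>Coordinates of a sum of two vectors in \<open>V\<close> lie between -2 and 2, so two
  such sums differ by at most 4. Here \<open>n k > 4\<close> enters.\<close>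

lemma shift_inj_V:
  assumes "a \<in> V" "b \<in> V" "c \<in> V" "e \<in> V" and eq: "shift n i (a + b) = shift n i (c + e)"
  shows "a + b = c + e"
proof (rule shift_inj[OF _ eq])
  fix k
  have "\<bar>a $ k\<bar> \<le> 1" "\<bar>b $ k\<bar> \<le> 1" "\<bar>c $ k\<bar> \<le> 1" "\<bar>e $ k\<bar> \<le> 1"
    using assms by (auto intro: V_coord_bound)
  then show "\<bar>(a + b) $ k - (c + e) $ k\<bar> < int (n k)"
    using n_gt_4[of k] unfolding vector_add_component by linarith
qed

lemma inj_on_shift_V: "inj_on (shift n i) V"
  using shift_inj_V[of _ 0 _ 0] by (auto intro!: inj_onI simp: zero_in_V)

text \<open>In the zero configuration all cells contribute the same value
  \<open>f (homog 0)\<close>, and the total must be 0.\<close>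

lemma number_conserving_quiescent:
  assumes "number_conserving n Q f" "0 \<in> Q"
  shows "f (homog 0) = 0"
proof -
  let ?x = "\<lambda>i\<in>cells n. 0"
  have "?x \<in> configs n Q" using \<open>0 \<in> Q\<close> by (auto simp: configs_def)
  then have "config_sum n (global_rule n f ?x) = config_sum n ?x"
    using assms by (auto simp: number_conserving_def)
  moreover have "nbhd_at n ?x i = homog 0" for i
    by (auto simp: nbhd_at_def homog_def shift_in_cells)
  ultimately have "real (card (cells n)) * f (homog 0) = 0"
    by (simp add: config_sum_def global_rule_def)
  then show ?thesis using card_cells_pos by simp
qed

section \<open>Embedding a neighborhood configuration into the torus\<close>

text \<open>A copy of \<open>N\<close> around the origin cell, zero elsewhere. The inverse recovers
  the vector from the cell, which is meaningful because \<open>shift n 0\<close> is injective on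
  \<open>V\<close>.\<close>

definition cross :: "(int ^ 'd \<Rightarrow> real) \<Rightarrow> int ^ 'd \<Rightarrow> real" where
  "cross N = (\<lambda>i\<in>cells n. if i \<in> shift n 0 ` V then N (inv_into V (shift n 0) i) else 0)"

lemma cross_shift: "a \<in> V \<Longrightarrow> cross N (shift n 0 a) = N a"
  by (simp add: cross_def shift_in_cells inv_into_f_f[OF inj_on_shift_V])

lemma cross_outside: "i \<in> cells n \<Longrightarrow> i \<notin> shift n 0 ` V \<Longrightarrow> cross N i = 0"
  by (simp add: cross_def)

lemma cross_in:
  assumes N: "N \<in> nbhd_configs Q" and Q: "0 \<in> Q"
  shows "cross N \<in> configs n Q"
proof -
  have "N v \<in> Q" if "v \<in> V" for v
    using N that by (auto simp: nbhd_configs_def)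
  then have "cross N i \<in> Q" if "i \<in> cells n" for i
    using Q that inv_into_into[of i "shift n 0" V] by (auto simp only: cross_def restrict_apply split: if_splits)
  then show ?thesis by (auto simp: configs_def cross_def)
qed

lemma config_sum_cross: "config_sum n (cross N) = sum N V"
proof -
  have "config_sum n (cross N) = sum (cross N) (shift n 0 ` V)"
    unfolding config_sum_def
    by (rule sum.mono_neutral_right) (auto simp: finite_cells shift_in_cells cross_outside)
  also have "\<dots> = sum N V"
    by (subst sum.reindex[OF inj_on_shift_V]) (simp add: cross_shift)
  finally show ?thesis .
qed

lemma nbhd_at_cross_0: "N \<in> nbhd_configs Q \<Longrightarrow> nbhd_at n (cross N) (shift n 0 0) = N"
  by (auto simp: nbhd_at_def shift_shift cross_shift nbhd_configs_def fun_eq_iff PiE_def extensional_def)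

text \<open>From position \<open>a + b\<close>, the cross cell \<open>a\<close> lies in direction
  \<open>- b\<close> and the cross cell \<open>b\<close> in direction \<open>- a\<close>. Seeing a
  cross cell \<open>c\<close> in direction \<open>z\<close> means \<open>a + b = c + - z\<close>,
  and uniqueness of such sums leaves no third direction.\<close>

lemma nbhd_at_cross_sum:
  assumes "a \<in> V" "b \<in> V" "a + b \<noteq> 0"
  shows "nbhd_at n (cross N) (shift n 0 (a + b)) = dimer (- b) (N a) (- a) (N b)"
proof
  fix z
  show "nbhd_at n (cross N) (shift n 0 (a + b)) z = dimer (- b) (N a) (- a) (N b) z"
  proof (cases "z \<in> V")
    case True
    have "cross N (shift n 0 (a + b + z)) = 0" if "z \<noteq> - b" "z \<noteq> - a"
    proof (rule cross_outside[OF shift_in_cells])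
      show "shift n 0 (a + b + z) \<notin> shift n 0 ` V"
      proof
        assume "shift n 0 (a + b + z) \<in> shift n 0 ` V"
        then obtain c where c: "c \<in> V" "shift n 0 (a + b + z) = shift n 0 c" by auto
        then have "shift n (shift n 0 (a + b + z)) (- z) = shift n (shift n 0 c) (- z)" by simp
        then have "shift n 0 (a + b) = shift n 0 (c + - z)" by (simp add: shift_shift)
        then have "a + b = c + - z"
          using assms True c by (intro shift_inj_V) (auto simp: uminus_in_V)
        then have "a = - z \<or> b = - z"
          using V_sum_eq_cases[of a b c "- z"] assms True c by (auto simp: uminus_in_V)
        then show False using that by auto
      qed
    qed
    then show ?thesis
      using True assms by (auto simp: nbhd_at_def dimer_def shift_shift cross_shift)
  qed (simp add: nbhd_at_def dimer_def)
qed

text \<open>A cell that sees the cross cell \<open>c\<close> in direction \<open>z\<close> sits at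
  \<open>c + - z\<close>, a sum of two vectors in \<open>V\<close>.\<close>

lemma nbhd_at_cross_outside:
  assumes i: "i \<in> cells n" and "\<And>a b. a \<in> V \<Longrightarrow> b \<in> V \<Longrightarrow> i \<noteq> shift n 0 (a + b)"
  shows "nbhd_at n (cross N) i = homog 0"
proof -
  have "cross N (shift n i z) = 0" if z: "z \<in> V" for z
  proof (rule cross_outside[OF shift_in_cells])
    show "shift n i z \<notin> shift n 0 ` V"
    proof
      assume "shift n i z \<in> shift n 0 ` V"
      then obtain c where c: "c \<in> V" "shift n i z = shift n 0 c" by auto
      then have "shift n (shift n i z) (- z) = shift n (shift n 0 c) (- z)" by simp
      then have "i = shift n 0 (c + - z)" using i by (simp add: shift_shift shift_0)
      then show False using assms(2)[of c "- z"] c z by (simp add: uminus_in_V)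
    qed
  qed
  then show ?thesis by (auto simp: nbhd_at_def homog_def)
qed

text \<open>
  The cells with a non-zero neighborhood are at the sums \<open>a + b\<close> with \<open>a, b \<in> V\<close>, and such a
  non-zero sum determines \<open>{a, b}\<close>. This needs side lengths above 4.
\<close>

lemma sum_global_rule_cross:
  assumes N: "N \<in> nbhd_configs Q" and f0: "f (homog 0) = 0"
  shows "config_sum n (global_rule n f (cross N))
    = f N + pair_sum (\<lambda>a b. f (dimer (- b) (N a) (- a) (N b))) Omega
      + (\<Sum>v\<in>Vplus. f (monomer (- v) (N v)))"
proof -
  define F where "F t = f (nbhd_at n (cross N) (shift n 0 t))" for t
  \<comment> \<open>The relevant positions \<open>T\<close> split by the shape of
    \<open>a + b\<close>: \<open>A\<close> collects sums over pairs in \<open>Omega\<close>,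
    \<open>B\<close> the doubled vectors, and opposite vectors (or two zeros) give the centre
    0.\<close>
  define A where "A = \<Sum> ` (Omega :: (int ^ 'd) set set)"
  define B where "B = (\<lambda>v. v + v) ` (Vplus :: (int ^ 'd) set)"
  define T where "T = {a + b | a b. a \<in> V \<and> b \<in> (V :: (int ^ 'd) set)}"
  have F: "F (a + b) = f (dimer (- b) (N a) (- a) (N b))" if "a \<in> V" "b \<in> V" "a + b \<noteq> 0" for a b
    using nbhd_at_cross_sum[OF that] by (simp add: F_def)
  have nz: "a + b \<noteq> 0" if "{a, b} \<in> Omega" for a b :: "int ^ 'd"
    using that by (auto simp: doubleton_in_Omega eq_neg_iff_add_eq_0)
  have nz': "v + v \<noteq> 0" if "v \<in> Vplus" for v :: "int ^ 'd"
    using that neq_uminus[of v] by (auto simp: Vplus_iff eq_neg_iff_add_eq_0)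
  have sum_pair: "\<exists>a b. P = {a, b} \<and> \<Sum>P = a + b \<and> a \<in> V \<and> b \<in> V \<and> a \<noteq> b \<and> a + b \<noteq> 0"
    if P: "P \<in> Omega" for P :: "(int ^ 'd) set"
  proof -
    obtain a b where "P = {a, b}" "a \<in> V" "b \<in> V" "a \<noteq> b" using P by (auto simp: Omega_eq)
    then show ?thesis using nz[of a b] P by (intro exI[of _ a] exI[of _ b]) auto
  qed
  have T: "T = insert 0 (A \<union> B)"
  proof
    show "T \<subseteq> insert 0 (A \<union> B)"
    proof
      fix t assume "t \<in> T"
      then obtain a b where ab: "t = a + b" "a \<in> V" "b \<in> V" by (auto simp: T_def)
      consider "t = 0" | "a = b" "a \<in> Vplus" | "{a, b} \<in> Omega" "a \<noteq> b"
        using ab by (cases "a + b = 0"; cases "a = b"; cases "a = 0") (auto simp: Vplus_iff doubleton_in_Omega eq_neg_iff_add_eq_0)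
      then show "t \<in> insert 0 (A \<union> B)"
      proof cases
        case 3
        then have "t = \<Sum>{a, b}" using ab by simp
        then show ?thesis unfolding A_def using 3 by blast
      qed (use ab in \<open>auto simp: B_def\<close>)
    qed
    have "0 + 0 \<in> T" unfolding T_def using zero_in_V by blast
    moreover have "A \<subseteq> T" unfolding A_def T_def using sum_pair by blast
    moreover have "B \<subseteq> T" unfolding B_def T_def using Vplus_iff by blast
    ultimately show "insert 0 (A \<union> B) \<subseteq> T" by auto
  qed
  have finite: "finite A" "finite B" by (simp_all add: A_def B_def finite_Omega finite_Vplus)
  have "0 \<notin> A \<union> B"
    using sum_pair nz' by (fastforce simp: A_def B_def)
  have disj: "A \<inter> B = {}"
  proof (rule ccontr)
    assume "A \<inter> B \<noteq> {}"
    then obtain P :: "(int ^ 'd) set" and v where P: "P \<in> Omega" and v: "v \<in> Vplus" "\<Sum>P = v + v" by (auto simp: A_def B_def)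
    obtain a b where ab: "a + b = v + v" "a \<in> V" "b \<in> V" "a \<noteq> b" "a + b \<noteq> 0"
      using sum_pair[OF P] v by auto
    then show False using V_sum_eq_cases[of a b v v] v by (auto simp: Vplus_iff)
  qed
  have inj_A: "inj_on \<Sum> (Omega :: (int ^ 'd) set set)"
  proof (rule inj_onI)
    fix P R :: "(int ^ 'd) set" assume PR: "P \<in> Omega" "R \<in> Omega" "\<Sum>P = \<Sum>R"
    obtain a b where ab: "P = {a, b}" "\<Sum>P = a + b" "a \<in> V" "b \<in> V" "a + b \<noteq> 0"
      using sum_pair[OF PR(1)] by blast
    obtain c e where ce: "R = {c, e}" "\<Sum>R = c + e" "c \<in> V" "e \<in> V"
      using sum_pair[OF PR(2)] by blast
    have "a = c \<and> b = e \<or> a = e \<and> b = c"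
      using V_sum_eq_cases[of a b c e] ab ce PR(3) by simp
    then show "P = R" using ab ce by (auto simp: insert_commute)
  qed
  have inj_B: "inj_on (\<lambda>v. v + v) (Vplus :: (int ^ 'd) set)"
  proof (rule inj_onI)
    fix v w :: "int ^ 'd" assume "v \<in> Vplus" "w \<in> Vplus" "v + v = w + w"
    then show "v = w" using V_sum_eq_cases[of v v w w] nz'[of v] by (auto simp: Vplus_iff)
  qed
  have inj_T: "inj_on (shift n 0) T"
    by (rule inj_onI) (auto simp: T_def intro: shift_inj_V)
  have "config_sum n (global_rule n f (cross N)) = (\<Sum>i\<in>cells n. f (nbhd_at n (cross N) i))"
    by (simp add: config_sum_def global_rule_def)
  also have "\<dots> = (\<Sum>i\<in>shift n 0 ` T. f (nbhd_at n (cross N) i))"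
  proof (rule sum.mono_neutral_right)
    show "\<forall>i\<in>cells n - shift n 0 ` T. f (nbhd_at n (cross N) i) = 0"
    proof
      fix i assume i: "i \<in> cells n - shift n 0 ` T"
      then have "nbhd_at n (cross N) i = homog 0"
        by (intro nbhd_at_cross_outside) (auto simp: T_def)
      then show "f (nbhd_at n (cross N) i) = 0" using f0 by simp
    qed
  qed (auto simp: finite_cells shift_in_cells)
  also have "\<dots> = sum F T"
    by (subst sum.reindex[OF inj_T]) (simp add: F_def)
  also have "\<dots> = F 0 + (sum F A + sum F B)"
    using \<open>0 \<notin> A \<union> B\<close> finite disj by (simp add: T sum.union_disjoint)
  also have "F 0 = f N" using nbhd_at_cross_0[OF N] by (simp add: F_def)
  also have "sum F A = pair_sum (\<lambda>a b. f (dimer (- b) (N a) (- a) (N b))) Omega"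
    unfolding A_def pair_sum_def
  proof (subst sum.reindex[OF inj_A], rule sum.cong[OF refl])
    fix P :: "(int ^ 'd) set" assume "P \<in> Omega"
    then obtain a b where ab: "P = {a, b}" "\<Sum>P = a + b" "a \<in> V" "b \<in> V" "a \<noteq> b" "a + b \<noteq> 0"
      using sum_pair by blast
    then show "(F \<circ> \<Sum>) P = on_pair (\<lambda>a b. f (dimer (- b) (N a) (- a) (N b))) P"
      using dimer_commute[of "- b" "- a" "N a" "N b"] by (simp add: on_pair_eq F)
  qed
  also have "sum F B = (\<Sum>v\<in>Vplus. f (monomer (- v) (N v)))"
    unfolding B_def
  proof (subst sum.reindex[OF inj_B], rule sum.cong[OF refl])
    fix v :: "int ^ 'd" assume v: "v \<in> Vplus"
    \<comment> \<open>At a doubled vector the two visible cross cells coincide, so the dimer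
      degenerates to a monomer.\<close>
    have "dimer (- v) (N v) (- v) (N v) = monomer (- v) (N v)"
      by (auto simp: dimer_def monomer_def restrict_def)
    then show "(F \<circ> (\<lambda>v. v + v)) v = f (monomer (- v) (N v))"
      using F[of v v] v nz'[OF v] by (simp add: Vplus_iff)
  qed
  finally show ?thesis by (simp add: add.assoc)
qed

end

subsection \<open>The equivalence\<close>

text \<open>Repeats the right-hand side of the final equivalence literally, so that its definition
  can be folded there.\<close>

definition reconstruction ::
    "int ^ 'd::finite \<Rightarrow> (int ^ 'd) set set \<Rightarrow> ((int ^ 'd \<Rightarrow> real) \<Rightarrow> real) \<Rightarrow> (int ^ 'd \<Rightarrow> real) \<Rightarrow> real" where
  "reconstruction \<eta> \<Lambda> f N = N \<eta>
         + pair_sum (\<lambda>u w. f (dimer u (N u) w (N w)) - f (dimer u (N (- w)) w (N (- u)))) \<Lambda>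
         + (\<Sum>v\<in>V - {\<eta>}. monomer_expansion f (homog (N v)))
         - pair_sum (\<lambda>u w. monomer_expansion f (dimer u (N u) w (N w))
                         + monomer_expansion f (dimer (- w) (N u) (- u) (N w))) \<Lambda>
         - (\<Sum>v\<in>Vplus. f (monomer v (N (- v))))"

section \<open>From number conservation to the formula\<close>

context torus
begin

text \<open>Equates the total state of \<open>cross N\<close> before and after one application of
  the global rule.\<close>

lemma number_conserving_expansion:
  assumes nc: "number_conserving n Q f" and Q: "0 \<in> Q" and N: "N \<in> nbhd_configs Q"
  shows "f N + pair_sum (\<lambda>a b. f (dimer (- b) (N a) (- a) (N b))) Omega
    + (\<Sum>v\<in>Vplus. f (monomer (- v) (N v))) = sum N V"
  using sum_global_rule_cross[of N Q f, OF N number_conserving_quiescent[OF nc Q]] cross_in[OF N Q] nc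
  by (simp add: number_conserving_def config_sum_cross)

text \<open>The part of a dimer value not explained by its two monomers. It vanishes as soon as one
  of the two states is 0, so sparse choices of \<open>N\<close> isolate single pairs.\<close>

definition interaction :: "((int ^ 'd \<Rightarrow> real) \<Rightarrow> real) \<Rightarrow> (int ^ 'd \<Rightarrow> real) \<Rightarrow> int ^ 'd \<Rightarrow> int ^ 'd \<Rightarrow> real" where
  "interaction f N a b =
    f (dimer (- b) (N a) (- a) (N b)) - (f (monomer (- b) (N a)) + f (monomer (- a) (N b)))"

lemma interaction_commute: "a \<noteq> b \<Longrightarrow> interaction f N a b = interaction f N b a"
  using dimer_commute[of "- b" "- a" "N a" "N b"] by (simp add: interaction_def)

lemma interaction_eq_0:
  assumes "f (homog 0) = 0" "a \<noteq> b" "N a = 0 \<or> N b = 0"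
  shows "interaction f N a b = 0"
  using assms by (auto simp: interaction_def dimer_0 dimer_0' monomer_0)

text \<open>Splitting every dimer value in the expansion into interaction and monomers leaves
  monomer terms indexed by pairs, which are then counted over all of \<open>Omega\<close>.\<close>

lemma number_conserving_interaction:
  assumes nc: "number_conserving n Q f" and Q: "0 \<in> Q" and N: "N \<in> nbhd_configs Q"
  shows "f N + pair_sum (interaction f N) Omega + (\<Sum>v\<in>V. monomer_expansion f (homog (N v)))
    = monomer_expansion f N + sum N V"
proof -
  let ?g = "\<lambda>a b. f (monomer (- b) (N a))"
  have "pair_sum (\<lambda>a b. f (dimer (- b) (N a) (- a) (N b))) Omega
      = pair_sum (\<lambda>a b. interaction f N a b + (?g a b + ?g b a)) Omega"
    by (rule pair_sum_cong) (simp add: interaction_def)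
  also have "\<dots> = pair_sum (interaction f N) Omega + pair_sum (\<lambda>a b. ?g a b + ?g b a) Omega"
    by (rule pair_sum_add) (auto simp: doubleton_in_Omega interaction_commute)
  also have "pair_sum (\<lambda>a b. ?g a b + ?g b a) Omega
      = (\<Sum>v\<in>V. monomer_expansion f (homog (N v))) - (\<Sum>v\<in>V. f (monomer (- v) (N v)))
        - (\<Sum>v\<in>Vplus. f (monomer v (N v)))"
    \<comment> \<open>The full square yields the expansions of \<open>homog (N v)\<close>. The
      diagonal cancels the sum over \<open>Vplus\<close> in the conservation identity up to its term
      at 0, which completes the antidiagonal to \<open>monomer_expansion f N\<close>.\<close>
    unfolding pair_sum_Omega
    by (simp add: sum_uminus_V[of "\<lambda>v. f (monomer v _)"] monomer_expansion_homog sum_subtractf)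
  finally show ?thesis
    using number_conserving_expansion[OF assms]
    by (simp add: sum_V monomer_expansion_def)
qed

text \<open>For the monomer at 0 every pair contains a vector with state 0, so all interactions
  vanish. Moreover \<open>f N\<close> equals its own monomer expansion and cancels, leaving the
  expansion of \<open>homog q\<close> against the total \<open>q\<close>.\<close>

lemma number_conserving_homog:
  assumes nc: "number_conserving n Q f" and Q: "0 \<in> Q" "q \<in> Q"
  shows "monomer_expansion f (homog q) = q"
proof -
  let ?M = "monomer 0 q :: int ^ 'd \<Rightarrow> real"
  note f0 = number_conserving_quiescent[OF nc Q(1)]
  have "pair_sum (interaction f ?M) Omega = pair_sum (\<lambda>u w. 0) (Omega :: (int ^ 'd) set set)"
  proof (rule pair_sum_cong)
    fix a b :: "int ^ 'd" assume "{a, b} \<in> Omega"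
    then have "a \<noteq> b" "?M a = 0 \<or> ?M b = 0" by (auto simp: doubleton_in_Omega monomer_apply)
    then show "interaction f ?M a b = 0" by (rule interaction_eq_0[of f, OF f0])
  qed
  moreover have "(\<Sum>v\<in>V. monomer_expansion f (homog (?M v))) = monomer_expansion f (homog q)"
    using zero_notin_Vplus
    by (auto simp: sum_V monomer_apply zero_in_V Vplus_iff monomer_expansion_homog monomer_0 f0
        intro!: sum.neutral)
  moreover have "sum ?M V = q"
    by (auto simp: sum_V monomer_apply zero_in_V Vplus_iff intro!: sum.neutral)
  ultimately show ?thesis
    using number_conserving_interaction[OF nc Q(1) monomer_in[OF Q(2,1)], of 0]
      monomer_expansion_monomer[of f, OF f0 zero_in_V, of q]
    by (simp add: pair_sum_0)
qed

text \<open>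
  For \<open>N\<close> a dimer at \<open>{u, w}\<close>, the only non-zero interaction is that of the pair \<open>{u, w}\<close> itself.
\<close>

lemma number_conserving_dimer:
  assumes nc: "number_conserving n Q f" and Q: "0 \<in> Q" "p \<in> Q" "q \<in> Q" and uw: "{u, w} \<in> Omega"
  shows "f (dimer u p w q) + f (dimer (- w) p (- u) q)
    = monomer_expansion f (dimer u p w q) + monomer_expansion f (dimer (- w) p (- u) q)"
proof -
  let ?D = "dimer u p w q"
  note f0 = number_conserving_quiescent[OF nc Q(1)]
  have V: "u \<in> V" "w \<in> V" "u \<noteq> w" using uw by (auto simp: doubleton_in_Omega)
  have "pair_sum (interaction f ?D) Omega = interaction f ?D u w"
  proof (rule pair_sum_single[OF order_refl uw interaction_commute[OF \<open>u \<noteq> w\<close>]])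
    fix a b assume ab: "{a, b} \<in> Omega" "{a, b} \<noteq> {u, w}"
    then have "a \<in> V" "b \<in> V" "a \<noteq> b" by (auto simp: doubleton_in_Omega)
    then show "interaction f ?D a b = 0"
      using ab(2) by (intro interaction_eq_0[of f, OF f0]) (auto simp: dimer_apply insert_commute)
  qed
  also have "\<dots> = f (dimer (- w) p (- u) q) - monomer_expansion f (dimer (- w) p (- u) q)"
    using V by (simp add: interaction_def dimer_apply monomer_expansion_dimer f0 uminus_in_V)
  finally have "pair_sum (interaction f ?D) Omega = \<dots>" .
  \<comment> \<open>These expansions add up to \<open>sum ?D V\<close> and cancel it in the
    interaction identity.\<close>
  moreover have "monomer_expansion f (homog (?D v)) = ?D v" if "v \<in> V" for v
    by (rule number_conserving_homog[OF nc Q(1)]) (use Q that in \<open>auto simp: dimer_apply\<close>)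
  ultimately show ?thesis
    using number_conserving_interaction[OF nc Q(1) dimer_in[OF Q(2,3,1)], of u w] by simp
qed

text \<open>The relation for matching dimers, summed over \<open>\<Lambda>\<close>, evaluates the
  sum over \<open>Omega\<close> in the conservation identity.\<close>

lemma number_conserving_imp_formula:
  assumes nc: "number_conserving n Q f" and Q: "0 \<in> Q" and \<eta>: "\<eta> \<in> V" and sel: "selection \<Lambda>"
    and N: "N \<in> nbhd_configs Q"
  shows "f N = reconstruction \<eta> \<Lambda> f N"
proof -
  let ?t1 = "\<lambda>u w. f (dimer u (N u) w (N w)) - f (dimer u (N (- w)) w (N (- u)))"
  let ?t2 = "\<lambda>u w. monomer_expansion f (dimer u (N u) w (N w))
    + monomer_expansion f (dimer (- w) (N u) (- u) (N w))"
  let ?G = "\<lambda>a b. f (dimer (- b) (N a) (- a) (N b))"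
  have \<Lambda>: "\<Lambda> \<subseteq> Omega" using sel by (simp add: selection_def)
  have NQ: "N v \<in> Q" if "v \<in> V" for v
    using N that by (auto simp: nbhd_configs_def)
  have G_commute: "?G a b = ?G b a" if "a \<noteq> b" for a b
    using that dimer_commute[of "- b" "- a" "N a" "N b"] by simp
  have t1_commute: "?t1 u w = ?t1 w u" if "u \<noteq> w" for u w
    using that by (simp add: dimer_commute)
  \<comment> \<open>The term \<open>?G (- u) (- w)\<close> is the dimer subtracted in
    \<open>?t1\<close>, up to order. What remains is the dimer relation with states
    \<open>N u\<close> and \<open>N w\<close>.\<close>
  have "pair_sum ?t2 \<Lambda> = pair_sum (\<lambda>u w. ?t1 u w + (?G u w + ?G (- u) (- w))) \<Lambda>"
  proof (rule pair_sum_cong)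
    fix u w assume "{u, w} \<in> \<Lambda>"
    then have uw: "{u, w} \<in> Omega" using \<Lambda> by auto
    then have "u \<in> V" "w \<in> V" "u \<noteq> w" by (auto simp: doubleton_in_Omega)
    then show "?t2 u w = ?t1 u w + (?G u w + ?G (- u) (- w))"
      using number_conserving_dimer[OF nc Q NQ[of u] NQ[of w] uw]
        dimer_commute[of u w "N (- w)" "N (- u)"] by simp
  qed
  also have "\<dots> = pair_sum ?t1 \<Lambda> + pair_sum (\<lambda>u w. ?G u w + ?G (- u) (- w)) \<Lambda>"
  proof (rule pair_sum_add[OF \<Lambda>])
    fix u w assume "{u, w} \<in> \<Lambda>"
    then have "{u, w} \<in> Omega" using \<Lambda> by auto
    then have "u \<noteq> w" by (auto simp: doubleton_in_Omega)
    then show "?t1 u w = ?t1 w u" "?G u w + ?G (- u) (- w) = ?G w u + ?G (- w) (- u)"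
      using t1_commute[of u w] G_commute[of u w] G_commute[of "- u" "- w"] by auto
  qed
  also have "pair_sum (\<lambda>u w. ?G u w + ?G (- u) (- w)) \<Lambda> = pair_sum ?G Omega"
    by (rule pair_sum_selection[OF sel]) (use G_commute in \<open>simp add: doubleton_in_Omega\<close>)
  finally have "pair_sum ?t2 \<Lambda> = pair_sum ?t1 \<Lambda> + pair_sum ?G Omega" .
  \<comment> \<open>Each state except \<open>N \<eta>\<close> is rewritten as the expansion of its
    homogeneous configuration; any \<open>\<eta>\<close> may be kept.\<close>
  moreover have "sum N V = N \<eta> + (\<Sum>v\<in>V - {\<eta>}. monomer_expansion f (homog (N v)))"
    using \<eta> by (simp add: sum.remove[OF finite_V] number_conserving_homog[OF nc Q NQ])
  moreover have "(\<Sum>v\<in>Vplus. f (monomer v (N (- v)))) = (\<Sum>v\<in>Vplus. f (monomer (- v) (N v)))"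
    using sum_uminus_Vplus[of "\<lambda>v. f (monomer (- v) (N v))"] by simp
  ultimately show ?thesis
    using number_conserving_expansion[OF nc Q N] by (simp add: reconstruction_def)
qed

end

section \<open>From the formula to number conservation\<close>

text \<open>At the zero configuration the formula becomes a linear equation in the single unknown
  \<open>f (homog 0)\<close>, whose coefficient turns out to be positive.\<close>

lemma formula_imp_quiescent:
  fixes f :: "(int ^ 'd::finite \<Rightarrow> real) \<Rightarrow> real"
  assumes sel: "selection \<Lambda>" and \<eta>: "\<eta> \<in> V"
    and N: "N = homog 0"
    and formula: "f N = reconstruction \<eta> \<Lambda> f N"
  shows "f (homog 0) = 0"
proof -
  define m where "m = real (card (Vplus :: (int ^ 'd) set))"
  define c where "c = (m + 1) * f (homog 0)"
  have \<Lambda>: "\<Lambda> \<subseteq> Omega" using sel by (simp add: selection_def)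
  have "(Vplus :: (int ^ 'd) set) \<noteq> {}" by (auto simp: Vplus_def)
  then have "card (Vplus :: (int ^ 'd) set) > 0" by (simp add: card_gt_0_iff finite_Vplus)
  then have "m \<ge> 1" unfolding m_def by linarith
  have N_V: "N v = 0" if "v \<in> V" for v using that N by (simp add: homog_def)
  have dimer_00: "dimer u 0 w 0 = homog 0" for u w :: "int ^ 'd"
    by (simp add: dimer_0 monomer_0)
  have expansion: "monomer_expansion f (homog 0) = c"
    by (simp add: monomer_expansion_homog monomer_0 card_V c_def m_def)
  have "pair_sum (\<lambda>u w. f (dimer u (N u) w (N w)) - f (dimer u (N (- w)) w (N (- u)))) \<Lambda>
      = pair_sum (\<lambda>u w. 0) \<Lambda>"
    using \<Lambda> by (intro pair_sum_cong) (auto simp: N_V doubleton_in_Omega uminus_in_V dest!: subsetD)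
  moreover have "pair_sum (\<lambda>u w. monomer_expansion f (dimer u (N u) w (N w))
        + monomer_expansion f (dimer (- w) (N u) (- u) (N w))) \<Lambda> = pair_sum (\<lambda>u w. c + c) \<Lambda>"
    using \<Lambda> by (intro pair_sum_cong) (auto simp: N_V dimer_00 expansion doubleton_in_Omega dest!: subsetD)
  \<comment> \<open>Summing \<open>c + c\<close> over the selection equals summing \<open>c\<close>
    over \<open>Omega\<close>, which has \<open>m\<^sup>2 / 2\<close> pairs.\<close>
  moreover have "pair_sum (\<lambda>u w. c + c) \<Lambda> = m\<^sup>2 * c / 2"
    using pair_sum_selection[OF sel, of "\<lambda>u w. c"] pair_sum_Omega[of "\<lambda>(u :: int ^ 'd) w. c / 2"]
    by (simp add: card_V m_def power2_eq_square field_simps)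
  moreover have "(\<Sum>v\<in>V - {\<eta>}. monomer_expansion f (homog (N v))) = m * c"
    using \<eta> by (simp add: N_V expansion card_V m_def)
  moreover have "(\<Sum>v\<in>Vplus. f (monomer v (N (- v)))) = m * f (homog 0)"
    by (simp add: N_V Vplus_iff uminus_in_V monomer_0 m_def)
  ultimately have "f (homog 0) = m * c - m\<^sup>2 * c / 2 - m * f (homog 0)"
    using formula \<eta> by (simp add: reconstruction_def N_V N[symmetric] pair_sum_0[OF \<Lambda>])
  then have "f (homog 0) * (1 + m\<^sup>2 * (m - 1) / 2) = 0"
    by (simp add: c_def power2_eq_square field_simps)
  moreover have "1 + m\<^sup>2 * (m - 1) / 2 > 0"
    using \<open>m \<ge> 1\<close> by (simp add: add_pos_nonneg)
  ultimately show ?thesis by simp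
qed

context torus
begin

text \<open>Each part of the formula is summed over all cells; translation invariance reduces the
  monomer parts to totals \<open>h v\<close> that depend on the vector alone.\<close>

lemma formula_imp_number_conserving:
  assumes Q: "0 \<in> Q" and \<eta>: "\<eta> \<in> V" and sel: "selection \<Lambda>"
    and formula: "\<And>N. N \<in> nbhd_configs Q \<Longrightarrow> f N = reconstruction \<eta> \<Lambda> f N"
  shows "number_conserving n Q f"
  unfolding number_conserving_def
proof
  fix x assume x: "x \<in> configs n Q"
  \<comment> \<open>Needed to evaluate the monomer expansions of dimers as two monomer values
    each.\<close>
  have f0: "f (homog 0) = 0"
    by (rule formula_imp_quiescent[OF sel \<eta> refl]) (rule formula[OF homog_in[OF Q]])
  have \<Lambda>: "\<Lambda> \<subseteq> Omega" using sel by (simp add: selection_def)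
  have \<Lambda>_V: "u \<in> V \<and> w \<in> V \<and> u \<noteq> w" if "{u, w} \<in> \<Lambda>" for u w
    using subsetD[OF \<Lambda> that] by (auto simp: doubleton_in_Omega)
  \<comment> \<open>\<open>X i v\<close> is the state that cell \<open>i\<close> sees in direction
    \<open>v\<close>; \<open>t1\<close> and \<open>t2\<close> are the two pair summands at cell
    \<open>i\<close>, with the expansions in \<open>t2\<close> already evaluated.\<close>
  define X where "X i v = x (shift n i v)" for i v
  define t1 where "t1 i u w = f (dimer u (X i u) w (X i w)) - f (dimer u (X i (- w)) w (X i (- u)))"
    for i u w
  define t2 where "t2 i u w = f (monomer u (X i u)) + f (monomer w (X i w))
      + (f (monomer (- w) (X i u)) + f (monomer (- u) (X i w)))" for i u w
  define h where "h v = (\<Sum>i\<in>cells n. f (monomer v (x i)))" for v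
  have t1_commute: "t1 i u w = t1 i w u" and t2_commute: "t2 i u w = t2 i w u"
    if "{u, w} \<in> \<Lambda>" for i u w
    using \<Lambda>_V[OF that] dimer_commute[of u w "X i u" "X i w"] dimer_commute[of u w "X i (- w)" "X i (- u)"]
    by (simp_all add: t1_def t2_def)
  have sum_X: "(\<Sum>i\<in>cells n. g (X i v)) = (\<Sum>i\<in>cells n. g (x i))" for g :: "real \<Rightarrow> real" and v
    unfolding X_def by (rule sum_shift)
  have f_nbhd: "f (nbhd_at n x i) = X i \<eta> + pair_sum (t1 i) \<Lambda>
      + (\<Sum>v\<in>V - {\<eta>}. monomer_expansion f (homog (X i v)))
      - pair_sum (t2 i) \<Lambda> - (\<Sum>v\<in>Vplus. f (monomer v (X i (- v))))" for i
  proof -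
    let ?N = "nbhd_at n x i"
    have N: "?N v = X i v" if "v \<in> V" for v using that by (simp add: nbhd_at_def X_def)
    have "pair_sum (\<lambda>u w. f (dimer u (?N u) w (?N w)) - f (dimer u (?N (- w)) w (?N (- u)))) \<Lambda>
        = pair_sum (t1 i) \<Lambda>"
      by (rule pair_sum_cong) (use \<Lambda>_V in \<open>simp add: N t1_def uminus_in_V\<close>)
    moreover have "pair_sum (\<lambda>u w. monomer_expansion f (dimer u (?N u) w (?N w))
          + monomer_expansion f (dimer (- w) (?N u) (- u) (?N w))) \<Lambda> = pair_sum (t2 i) \<Lambda>"
    proof (rule pair_sum_cong)
      fix u w assume "{u, w} \<in> \<Lambda>"
      then have "u \<in> V" "w \<in> V" "u \<noteq> w" "- w \<noteq> - u" using \<Lambda>_V[of u w] by auto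
      then show "monomer_expansion f (dimer u (?N u) w (?N w))
          + monomer_expansion f (dimer (- w) (?N u) (- u) (?N w)) = t2 i u w"
        using monomer_expansion_dimer[of f u w "X i u" "X i w", OF f0]
          monomer_expansion_dimer[of f "- w" "- u" "X i u" "X i w", OF f0]
        by (simp add: N t2_def uminus_in_V)
    qed
    ultimately show ?thesis
      using \<eta> by (simp add: formula[OF nbhd_at_in[OF x]] reconstruction_def N uminus_in_V Vplus_iff)
  qed
  have "(\<Sum>i\<in>cells n. pair_sum (t1 i) \<Lambda>) = pair_sum (\<lambda>u w. \<Sum>i\<in>cells n. t1 i u w) \<Lambda>"
    by (rule pair_sum_sum[OF \<Lambda> t1_commute])
  also have "\<dots> = pair_sum (\<lambda>u w. 0) \<Lambda>"
  proof (rule pair_sum_cong)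
    fix u w
    show "(\<Sum>i\<in>cells n. t1 i u w) = 0"
      \<comment> \<open>The dimer subtracted at the cell reached from \<open>i\<close> by
        \<open>u + w\<close> has the states at \<open>u\<close> and \<open>w\<close> seen from
        \<open>i\<close>, so the two sums agree after translation.\<close>
      using sum_shift[of "\<lambda>i. f (dimer u (X i (- w)) w (X i (- u)))" "u + w"]
      by (simp add: t1_def X_def shift_shift sum_subtractf)
  qed
  finally have t1: "(\<Sum>i\<in>cells n. pair_sum (t1 i) \<Lambda>) = 0" by (simp add: pair_sum_0[OF \<Lambda>])
  have "(\<Sum>i\<in>cells n. pair_sum (t2 i) \<Lambda>) = pair_sum (\<lambda>u w. \<Sum>i\<in>cells n. t2 i u w) \<Lambda>"
    by (rule pair_sum_sum[OF \<Lambda> t2_commute])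
  also have "\<dots> = pair_sum (\<lambda>u w. h u + h w + (h (- u) + h (- w))) \<Lambda>"
    by (rule pair_sum_cong)
      (simp add: t2_def h_def sum.distrib sum_X[of "\<lambda>q. f (monomer _ q)"])
  also have "\<dots> = pair_sum (\<lambda>u w. h u + h w) Omega"
    by (rule pair_sum_selection[OF sel]) simp
  \<comment> \<open>Each vector is paired with all others in \<open>V\<close>, except that a
    non-zero one is not paired with its negative.\<close>
  also have "\<dots> = real (card (V - {\<eta>})) * sum h V - sum h Vplus"
    using \<eta> pair_sum_Omega[of "\<lambda>u w. h u"]
    by (simp add: card_V sum_subtractf sum_distrib_right algebra_simps sum.distrib)
  finally have t2: "(\<Sum>i\<in>cells n. pair_sum (t2 i) \<Lambda>) = \<dots>" .
  have "(\<Sum>i\<in>cells n. \<Sum>v\<in>V - {\<eta>}. monomer_expansion f (homog (X i v)))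
      = (\<Sum>v\<in>V - {\<eta>}. \<Sum>i\<in>cells n. monomer_expansion f (homog (x i)))"
    by (subst sum.swap) (simp add: sum_X[of "\<lambda>q. monomer_expansion f (homog q)"])
  also have "(\<Sum>i\<in>cells n. monomer_expansion f (homog (x i))) = sum h V"
    unfolding monomer_expansion_homog h_def by (rule sum.swap)
  finally have t3: "(\<Sum>i\<in>cells n. \<Sum>v\<in>V - {\<eta>}. monomer_expansion f (homog (X i v)))
      = real (card (V - {\<eta>})) * sum h V" by simp
  have t4: "(\<Sum>i\<in>cells n. \<Sum>v\<in>Vplus. f (monomer v (X i (- v)))) = sum h Vplus"
    by (subst sum.swap) (simp add: sum_X[of "\<lambda>q. f (monomer _ q)"] h_def)
  have "config_sum n (global_rule n f x) = (\<Sum>i\<in>cells n. f (nbhd_at n x i))"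
    by (simp add: config_sum_def global_rule_def)
  \<comment> \<open>The total \<open>t3\<close> of the homogeneous expansions balances
    \<open>t2\<close> and \<open>t4\<close>, and \<open>t1\<close> is 0, so only the states in
    direction \<open>\<eta>\<close> survive.\<close>
  also have "\<dots> = (\<Sum>i\<in>cells n. X i \<eta>)"
    by (simp add: f_nbhd sum.distrib sum_subtractf t1 t2 t3 t4)
  finally show "config_sum n (global_rule n f x) = config_sum n x"
    using sum_X[of "\<lambda>q. q" \<eta>] by (simp add: config_sum_def)
qed

end

theorem theorem4p3:
  fixes n :: "'d::finite \<Rightarrow> nat"
    and Q :: "real set"
    and f :: "(int ^ 'd \<Rightarrow> real) \<Rightarrow> real"
    and \<eta> :: "int ^ 'd"
    and \<Lambda> :: "(int ^ 'd) set set"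
  assumes "\<And>k. n k > 4"
    and "\<exists>p\<in>Q. \<exists>q\<in>Q. p \<noteq> q"
    and "0 \<in> Q"
    and "local_rule Q f"
    and "\<eta> \<in> V"
    and "selection \<Lambda>"
  shows "number_conserving n Q f \<longleftrightarrow>
    (\<forall>N\<in>nbhd_configs Q.
       f N = N \<eta>
         + pair_sum (\<lambda>u w. f (dimer u (N u) w (N w)) - f (dimer u (N (- w)) w (N (- u)))) \<Lambda>
         + (\<Sum>v\<in>V - {\<eta>}. monomer_expansion f (homog (N v)))
         - pair_sum (\<lambda>u w. monomer_expansion f (dimer u (N u) w (N w))
                         + monomer_expansion f (dimer (- w) (N u) (- u) (N w))) \<Lambda>
         - (\<Sum>v\<in>Vplus. f (monomer v (N (- v)))))"
proof -
  interpret torus n by unfold_locales (rule assms(1))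
  show ?thesis
    unfolding reconstruction_def[symmetric]
    using number_conserving_imp_formula[OF _ assms(3,5,6), of f]
      formula_imp_number_conserving[OF assms(3,5,6), of f]
    by blast
qed

end
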